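(* Let $\mathcal D$ be a probability distribution on $\mathcal X\times\mathcal Y$, let $m\ge1$, and let $\delta\in[0,1]$. For each sample $S\in(\mathcal X\times\mathcal Y)^m$ and each probability distribution $Q$ over $\mathcal H$, let $\tilde L_S^Q,\tilde b_S^Q,\tilde c_S^Q$ be real numbers such that (1) $\mathbb P_{S\sim\mathcal D^m}\big(\forall Q\text{ over }\mathcal H:\ \mathbb E_{\mathbf h'\sim Q}\mathcal L_{\mathcal D}(\mathbf h')\le\tilde L_S^Q\big)\ge1-\delta$; (2) for all samples $S$, all $Q$ over $\mathcal H$ and all $\mathbf h\in\mathcal H$: $b_{\mathcal D}^Q(\mathbf h)\ge\tilde b_S^Q$ and $c_{\mathcal D}^Q(\mathbf h)\ge\tilde c_S^Q$ (each inequality being required whenever its left-hand side is well defined); (3) $\tilde c_S^Q>\tilde b_S^Q$ for all $S$ and $Q$. Then $$\mathbb P_{S\sim\mathcal D^m}\left(\forall Q\text{ over }\mathcal H,\ \forall\,\mathbf h\in\mathcal H:\ \mathcal L_{\mathcal D}(\mathbf h)\le\frac{\tilde L_S^Q-\tilde b_S^Q}{\tilde c_S^Q-\tilde b_S^Q}\right)\ge1-\delta.$$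
   Context: $\mathcal X$ is a feature space, $\mathcal Y$ a finite label set, $\mathcal H$ a set of predictors $\mathbf h:\mathcal X\to\mathcal Y'$, and $\ell:\mathcal Y'\times\mathcal Y\to\{0,1\}$ a binary loss (all objects and events are assumed measurable as needed). $\mathcal L_{\mathcal D}(\mathbf h)=\mathbb E_{(\mathbf x,\mathbf y)\sim\mathcal D}[\ell(\mathbf h(\mathbf x),\mathbf y)]$. Define $$b_{\mathcal D}^Q(\mathbf h)=\mathbb E_{(\mathbf x,\mathbf y)\sim\mathcal D}\Big[\mathbb E_{\mathbf h'\sim Q}\,\ell(\mathbf h'(\mathbf x),\mathbf y)\,\Big|\,\ell(\mathbf h(\mathbf x),\mathbf y)=0\Big],\qquad c_{\mathcal D}^Q(\mathbf h)=\mathbb E_{(\mathbf x,\mathbf y)\sim\mathcal D}\Big[\mathbb E_{\mathbf h'\sim Q}\,\ell(\mathbf h'(\mathbf x),\mathbf y)\,\Big|\,\ell(\mathbf h(\mathbf x),\mathbf y)=1\Big],$$ each well defined when its conditioning event has positive $\mathcal D$-probability. *)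

theory Defs
  imports "HOL-Probability.Probability"
begin

definition risk :: "('p \<Rightarrow> 'y \<Rightarrow> real) \<Rightarrow> ('x \<times> 'y) measure \<Rightarrow> ('x \<Rightarrow> 'p) \<Rightarrow> real" where
  "risk l D h = (\<integral>z. l (h (fst z)) (snd z) \<partial>D)"

definition loss_event ::
  "('p \<Rightarrow> 'y \<Rightarrow> real) \<Rightarrow> ('x \<times> 'y) measure \<Rightarrow> ('x \<Rightarrow> 'p) \<Rightarrow> real \<Rightarrow> ('x \<times> 'y) set" where
  "loss_event l D h v = {z \<in> space D. l (h (fst z)) (snd z) = v}"

(* Conditioning on an event E of positive probability is integration against
   uniform_measure D E, i.e. the measure A \<mapsto> D (E \<inter> A) / D E.
   The value is only meaningful when loss_event l D h v has positive probability. *)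
definition cond_gibbs_loss ::
  "('p \<Rightarrow> 'y \<Rightarrow> real) \<Rightarrow> ('x \<times> 'y) measure \<Rightarrow> ('x \<Rightarrow> 'p) measure \<Rightarrow> ('x \<Rightarrow> 'p) \<Rightarrow> real \<Rightarrow> real" where
  "cond_gibbs_loss l D Q h v =
     (\<integral>z. (\<integral>h'. l (h' (fst z)) (snd z) \<partial>Q) \<partial>uniform_measure D (loss_event l D h v))"

definition b_coeff ::
  "('p \<Rightarrow> 'y \<Rightarrow> real) \<Rightarrow> ('x \<times> 'y) measure \<Rightarrow> ('x \<Rightarrow> 'p) measure \<Rightarrow> ('x \<Rightarrow> 'p) \<Rightarrow> real" where
  "b_coeff l D Q h = cond_gibbs_loss l D Q h 0"

definition c_coeff ::
  "('p \<Rightarrow> 'y \<Rightarrow> real) \<Rightarrow> ('x \<times> 'y) measure \<Rightarrow> ('x \<Rightarrow> 'p) measure \<Rightarrow> ('x \<Rightarrow> 'p) \<Rightarrow> real" where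
  "c_coeff l D Q h = cond_gibbs_loss l D Q h 1"

(* The law of m independent draws from D; a sample is indexed by {..<m}. *)
definition sample_measure :: "nat \<Rightarrow> 'z measure \<Rightarrow> (nat \<Rightarrow> 'z) measure" where
  "sample_measure m D = PiM {..<m} (\<lambda>_. D)"

(* The feature space is the measurable space X, the label set Y carries the discrete
   sigma-algebra, and the predictor class is the space of the measure H, whose
   sigma-algebra is the one on which the distributions Q live. Predictors take values in Y'.
   The last condition makes the loss measurable jointly in predictor and example, so that
   the risks, the conditional losses and the exchange of the expectations over Q and D
   make sense. *)
definition learning_setup ::
  "'x measure \<Rightarrow> 'y set \<Rightarrow> 'p set \<Rightarrow> ('x \<Rightarrow> 'p) measure \<Rightarrow> ('p \<Rightarrow> 'y \<Rightarrow> real) \<Rightarrow> bool" where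
  "learning_setup X Y Y' H l \<longleftrightarrow>
     finite Y \<and>
     space H \<subseteq> space X \<rightarrow> Y' \<and>
     (\<forall>p\<in>Y'. \<forall>y\<in>Y. l p y \<in> {0, 1}) \<and>
     (\<lambda>(h, z). l (h (fst z)) (snd z)) \<in> borel_measurable (H \<Otimes>\<^sub>M (X \<Otimes>\<^sub>M count_space Y))"

end

theory Submission
  imports Defs
begin

text \<open>Conditioning on whether \<open>h\<close> errs and using Fubini, the Gibbs risk of \<open>Q\<close> equals
  \<open>(1 - L) b + L c\<close> with \<open>L\<close> the risk of \<open>h\<close>. Under the lower bounds on \<open>b\<close> and \<open>c\<close> this is at
  least an increasing affine function of \<open>L\<close>, which is then inverted. The argument is deterministic
  in the sample, so the event of hypothesis (1) is contained in the event of the conclusion.\<close>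

text \<open>Scaling the conditional expectation by \<open>measure M E\<close> lets the identity
  survive a null \<open>E\<close>: both sides are then 0, whatever value the ill-defined conditional
  integral takes.\<close>

lemma integral_uniform_measure_mult:
  fixes f :: "'a \<Rightarrow> real"
  assumes "finite_measure M" "E \<in> sets M" "f \<in> borel_measurable M"
  shows "measure M E * (\<integral>x. f x \<partial>uniform_measure M E) = (\<integral>x. indicator E x * f x \<partial>M)"
proof (cases "measure M E = 0")
  case True
  interpret finite_measure M by fact
  have "E \<in> null_sets M"
    using True assms(2) by (simp add: null_sets_def emeasure_eq_measure)
  then have "AE x in M. indicator E x * f x = 0"
    by (auto dest!: AE_not_in elim!: eventually_mono)
  then have "(\<integral>x. indicator E x * f x \<partial>M) = 0"
    by (rule integral_eq_zero_AE)
  with True show ?thesis by simp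
next
  case False
  interpret finite_measure M by fact
  have pos: "measure M E > 0"
    using False by (simp add: zero_less_measure_iff)
  \<comment> \<open>Because \<open>E\<close> has positive mass, the \<open>ennreal\<close> quotient
    defining \<open>uniform_measure\<close> is a quotient of reals, which is the shape of density
    that \<open>integral_density\<close> accepts.\<close>
  have eq: "uniform_measure M E = density M (\<lambda>x. ennreal (indicator E x / measure M E))"
    unfolding uniform_measure_def
    by (intro density_cong)
      (use assms pos in \<open>auto simp: emeasure_eq_measure divide_ennreal ennreal_indicator[symmetric] simp del: ennreal_indicator\<close>)
  have "(\<integral>x. f x \<partial>uniform_measure M E) = (\<integral>x. (indicator E x / measure M E) * f x \<partial>M)"
    unfolding eq
    by (subst integral_density) (use assms pos in auto)
  also have "\<dots> = (\<integral>x. indicator E x * f x \<partial>M) / measure M E"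
    by (simp flip: integral_divide_zero)
  finally show ?thesis using pos by simp
qed

text \<open>A loss with values in {0, 1} is the indicator of the error event, so its mean is the
  mass of that event. The last equation is the law of total expectation over correct and wrong
  examples; a coefficient whose conditioning event is null enters with weight 0, so it holds for
  every \<open>h\<close>.\<close>

lemma gibbs_risk_eq:
  assumes learning: "learning_setup X Y Y' H l"
    and D: "D \<in> space (prob_algebra (X \<Otimes>\<^sub>M count_space Y))"
    and Q: "Q \<in> space (prob_algebra H)"
    and h: "h \<in> space H"
  shows "measure D (loss_event l D h 0) = 1 - risk l D h"
    and "measure D (loss_event l D h 1) = risk l D h"
    and "(\<integral>h'. risk l D h' \<partial>Q) =
      (1 - risk l D h) * b_coeff l D Q h + risk l D h * c_coeff l D Q h"
proof -
  let ?Z = "X \<Otimes>\<^sub>M count_space Y"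
  have [measurable_cong]: "sets D = sets ?Z" and "prob_space D"
    using D by (auto simp: space_prob_algebra)
  have [measurable_cong]: "sets Q = sets H" and "prob_space Q"
    using Q by (auto simp: space_prob_algebra)
  interpret D: prob_space D by fact
  interpret Q: prob_space Q by fact
  interpret QD: pair_prob_space Q D ..
  have spD: "space D = space X \<times> Y" and spQ: "space Q = space H"
    using sets_eq_imp_space_eq[OF \<open>sets D = sets ?Z\<close>] sets_eq_imp_space_eq[OF \<open>sets Q = sets H\<close>]
    by (auto simp: space_pair_measure)
  have meas[measurable]: "(\<lambda>(h, z). l (h (fst z)) (snd z)) \<in> borel_measurable (H \<Otimes>\<^sub>M ?Z)"
    using learning by (simp add: learning_setup_def)
  have val: "l (k (fst z)) (snd z) \<in> {0, 1}" if "k \<in> space H" "z \<in> space D" for k z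
    using learning that unfolding learning_setup_def spD by (fastforce simp: Pi_iff subset_iff)
  have measQD: "(\<lambda>(h, z). l (h (fst z)) (snd z)) \<in> borel_measurable (Q \<Otimes>\<^sub>M D)"
    by measurable
  have meas_h[measurable]: "(\<lambda>z. l (h (fst z)) (snd z)) \<in> borel_measurable D"
    using measurable_compose[OF measurable_Pair1'[of h Q D] measQD] h by (simp add: spQ)
  define g where "g z = (\<integral>h'. l (h' (fst z)) (snd z) \<partial>Q)" for z
  \<comment> \<open>The loss is bounded by 1 on a product of probability spaces; this integrability
    gives both that of \<open>g\<close> and the exchange of integrals.\<close>
  have intQD: "integrable (Q \<Otimes>\<^sub>M D) (\<lambda>(h, z). l (h (fst z)) (snd z))"
    by (rule QD.integrable_const_bound[where B = 1, OF _ measQD])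
      (use val in \<open>force intro!: AE_I2 simp: space_pair_measure spQ\<close>)
  have int_g: "integrable D g"
    using QD.integrable_snd[OF intQD] by (simp add: g_def[abs_def])
  then have [measurable]: "g \<in> borel_measurable D" by simp
  let ?E = "loss_event l D h"
  have [measurable]: "?E v \<in> sets D" for v
    unfolding loss_event_def by measurable
  \<comment> \<open>The two indicators sum to 1 on \<open>space D\<close>, which is what later
    splits \<open>g\<close> into its parts on \<open>?E 0\<close> and \<open>?E 1\<close>.\<close>
  have ind1: "indicator (?E 1) z = l (h (fst z)) (snd z)"
    and ind0: "indicator (?E 0) z = 1 - l (h (fst z)) (snd z)" if "z \<in> space D" for z
    using val[OF h that] that by (auto simp: loss_event_def indicator_def)
  have "measure D (?E 1) = (\<integral>z. indicator (?E 1) z \<partial>D)"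
    using sets.sets_into_space[of "?E 1" D] by (simp add: Int_absorb2)
  also have "\<dots> = risk l D h"
    unfolding risk_def by (intro Bochner_Integration.integral_cong refl ind1)
  finally show P1: "measure D (?E 1) = risk l D h" .
  have "?E 0 = space D - ?E 1"
    using val[OF h] by (auto simp: loss_event_def)
  then show P0: "measure D (?E 0) = 1 - risk l D h"
    using P1 by (simp add: D.prob_compl)
  have "(\<integral>h'. risk l D h' \<partial>Q) = (\<integral>z. g z \<partial>D)"
    unfolding risk_def g_def using QD.Fubini_integral[OF intQD] by simp
  also have "\<dots> = (\<integral>z. indicator (?E 0) z * g z + indicator (?E 1) z * g z \<partial>D)"
    by (intro Bochner_Integration.integral_cong refl)
      (simp only: ind0 ind1, simp add: algebra_simps)
  also have "\<dots> = (\<integral>z. indicator (?E 0) z * g z \<partial>D) + (\<integral>z. indicator (?E 1) z * g z \<partial>D)"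
    by (intro Bochner_Integration.integral_add)
      (use integrable_mult_indicator[OF _ int_g] in simp_all)
  also have "\<dots> = measure D (?E 0) * b_coeff l D Q h + measure D (?E 1) * c_coeff l D Q h"
    unfolding b_coeff_def c_coeff_def cond_gibbs_loss_def g_def[symmetric]
    by (subst (1 2) integral_uniform_measure_mult) (auto intro: D.finite_measure_axioms)
  finally show "(\<integral>h'. risk l D h' \<partial>Q) =
      (1 - risk l D h) * b_coeff l D Q h + risk l D h * c_coeff l D Q h"
    unfolding P0 P1 .
qed

theorem corollary2:
  fixes X :: "'x measure" and Y :: "'y set" and Y' :: "'p set"
    and H :: "('x \<Rightarrow> 'p) measure" and l :: "'p \<Rightarrow> 'y \<Rightarrow> real"
    and D :: "('x \<times> 'y) measure" and m :: nat and \<delta> :: real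
    and Lt bt ct :: "(nat \<Rightarrow> 'x \<times> 'y) \<Rightarrow> ('x \<Rightarrow> 'p) measure \<Rightarrow> real"
  assumes learning: "learning_setup X Y Y' H l"
    and D: "D \<in> space (prob_algebra (X \<Otimes>\<^sub>M count_space Y))"
    and m: "m \<ge> 1"
    and \<delta>: "0 \<le> \<delta>" "\<delta> \<le> 1"
    and risk_event:
      "{S \<in> space (sample_measure m D). \<forall>Q\<in>space (prob_algebra H).
          (\<integral>h'. risk l D h' \<partial>Q) \<le> Lt S Q} \<in> sets (sample_measure m D)"
    and bound_event:
      "{S \<in> space (sample_measure m D). \<forall>Q\<in>space (prob_algebra H). \<forall>h\<in>space H.
          risk l D h \<le> (Lt S Q - bt S Q) / (ct S Q - bt S Q)} \<in> sets (sample_measure m D)"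
    and risk_bound:
      "\<P>(S in sample_measure m D. \<forall>Q\<in>space (prob_algebra H).
          (\<integral>h'. risk l D h' \<partial>Q) \<le> Lt S Q) \<ge> 1 - \<delta>"
    and b_bound:
      "\<And>S Q h. S \<in> space (sample_measure m D) \<Longrightarrow> Q \<in> space (prob_algebra H) \<Longrightarrow> h \<in> space H \<Longrightarrow>
          measure D (loss_event l D h 0) > 0 \<Longrightarrow> b_coeff l D Q h \<ge> bt S Q"
    and c_bound:
      "\<And>S Q h. S \<in> space (sample_measure m D) \<Longrightarrow> Q \<in> space (prob_algebra H) \<Longrightarrow> h \<in> space H \<Longrightarrow>
          measure D (loss_event l D h 1) > 0 \<Longrightarrow> c_coeff l D Q h \<ge> ct S Q"
    and separation:
      "\<And>S Q. S \<in> space (sample_measure m D) \<Longrightarrow> Q \<in> space (prob_algebra H) \<Longrightarrow> ct S Q > bt S Q"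
  shows "\<P>(S in sample_measure m D. \<forall>Q\<in>space (prob_algebra H). \<forall>h\<in>space H.
          risk l D h \<le> (Lt S Q - bt S Q) / (ct S Q - bt S Q)) \<ge> 1 - \<delta>"
proof -
  let ?M = "sample_measure m D"
  let ?A = "{S \<in> space ?M. \<forall>Q\<in>space (prob_algebra H). (\<integral>h'. risk l D h' \<partial>Q) \<le> Lt S Q}"
  let ?B = "{S \<in> space ?M. \<forall>Q\<in>space (prob_algebra H). \<forall>h\<in>space H.
          risk l D h \<le> (Lt S Q - bt S Q) / (ct S Q - bt S Q)}"
  have "prob_space D" using D by (simp add: space_prob_algebra)
  then interpret M: prob_space ?M
    unfolding sample_measure_def by (intro prob_space_PiM)
  \<comment> \<open>The Gibbs risk of \<open>Q\<close> does not depend on \<open>h\<close>, so one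
    bound on it serves all \<open>h\<close> at once and costs no further probability.\<close>
  have "?A \<subseteq> ?B"
  proof safe
    fix S Q h
    assume S: "S \<in> space ?M" and Q: "Q \<in> space (prob_algebra H)" and h: "h \<in> space H"
      and *: "\<forall>Q\<in>space (prob_algebra H). (\<integral>h'. risk l D h' \<partial>Q) \<le> Lt S Q"
    note eq = gibbs_risk_eq[OF learning D Q h]
    let ?L = "risk l D h"
    \<comment> \<open>If the weight is 0, \<open>b_bound\<close> gives no information but both sides
      vanish. Otherwise the weight, being the mass of the event where \<open>h\<close> is correct,
      is positive and \<open>b_bound\<close> applies. The term with \<open>c_coeff\<close> is
      treated alike.\<close>
    have "(1 - ?L) * bt S Q \<le> (1 - ?L) * b_coeff l D Q h"
      using b_bound[OF S Q h] measure_nonneg[of D "loss_event l D h 0"]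
      unfolding eq(1) by (cases "1 - ?L = 0") (auto intro: mult_left_mono)
    moreover have "?L * ct S Q \<le> ?L * c_coeff l D Q h"
      using c_bound[OF S Q h] measure_nonneg[of D "loss_event l D h 1"]
      unfolding eq(2) by (cases "?L = 0") (auto intro: mult_left_mono)
    ultimately have "(1 - ?L) * bt S Q + ?L * ct S Q \<le> Lt S Q"
      using * Q eq(3) by fastforce
    \<comment> \<open>The left side of the last inequality is
      \<open>bt S Q + ?L * (ct S Q - bt S Q)\<close>; \<open>separation\<close> makes the slope
      positive, so dividing by it keeps the direction.\<close>
    then show "?L \<le> (Lt S Q - bt S Q) / (ct S Q - bt S Q)"
      using separation[OF S Q] by (simp add: pos_le_divide_eq algebra_simps)
  qed
  then have "measure ?M ?A \<le> measure ?M ?B"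
    by (rule M.finite_measure_mono[OF _ bound_event])
  with risk_bound show ?thesis by simp
qed

end
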